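(* Let $n=2p_1^{e_1}p_2^{e_2}\cdots p_r^{e_r}$, where $p_1,\dots,p_r$ are distinct odd primes, $e_i\ge1$, and $r$ is fixed. Let ${\rm NonNor}(n)$ be the set of non-normal circulant digraphs of order $n$, ${\rm Nor}(n)$ the set of normal circulant digraphs of order $n$, and ${\rm DRR}(n)$ the set of circulant digraphs $\Gamma$ of order $n$ with ${\rm Aut}(\Gamma)=\langle\rho\rangle$. Then $$\lim_{n\to\infty,\ r\ {\rm fixed}}\frac{\vert{\rm NonNor}(n)\vert}{\vert{\rm Nor}(n)\setminus{\rm DRR}(n)\vert}\ \ge\ \frac{1}{4(2^r-1)}.$$
   Context: A circulant digraph of order $n$ is the digraph $\Gamma(\mathbb{Z}_n,S)$ with vertex set $\mathbb{Z}_n$ and arc set $\{(u,v): u-v\in S\}$, where $S\subseteq\mathbb{Z}_n\setminus\{0\}$. Circulant digraphs of order $n$ are counted as labelled objects, i.e. by their connection sets. Let $\rho:\mathbb{Z}_n\to\mathbb{Z}_n$, $\rho(i)=i+1$; then $\langle\rho\rangle\le{\rm Aut}(\Gamma)$ is a regular cyclic group. $\Gamma$ is normal if $\langle\rho\rangle\trianglelefteq{\rm Aut}(\Gamma)$, and a DRR if ${\rm Aut}(\Gamma)=\langle\rho\rangle$.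
   Formalization: The limit is replaced by the limit inferior over the orders n with r ≥ 1 fixed, since the limit itself need not exist: for r = 1 the ratio tends to 2 along n = 2p but to infinity along n = 2p². *)

theory Defs
  imports
    "HOL-Analysis.Analysis"
    "HOL-Computational_Algebra.Primes"
    "HOL-Algebra.Bij"
    "HOL-Algebra.Coset"
    "HOL-Algebra.Generated_Groups"
    "Graph_Theory.Pair_Digraph"
begin

text \<open>The elements of \<open>\<int>\<^sub>n\<close> are represented by their residues \<open>0, \<dots>, n - 1\<close>.\<close>

definition Zn :: "nat \<Rightarrow> int set" where
  "Zn n = {0..<int n}"

definition circulant :: "nat \<Rightarrow> int set \<Rightarrow> int pair_pre_digraph" where
  "circulant n S = \<lparr> pverts = Zn n,
     parcs = {(u, v). u \<in> Zn n \<and> v \<in> Zn n \<and> (u - v) mod int n \<in> S} \<rparr>"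

text \<open>
  Labelled digraphs, not isomorphism classes: distinct connection sets give distinct digraphs
  (lemma \<open>inj_on_circulant\<close>), so cardinalities of subsets of this set count connection sets.
\<close>

definition Circulants :: "nat \<Rightarrow> int pair_pre_digraph set" where
  "Circulants n = circulant n ` Pow (Zn n - {0})"

text \<open>
  Permutations are elements of \<^const>\<open>Bij\<close>, hence functions that are undefined outside the
  vertex set; \<open>AutGroup \<Gamma>\<close> is the automorphism group as a permutation group under composition.
\<close>

definition Aut :: "'a pair_pre_digraph \<Rightarrow> ('a \<Rightarrow> 'a) set" where
  "Aut \<Gamma> = {f \<in> Bij (pverts \<Gamma>). \<forall>u \<in> pverts \<Gamma>. \<forall>v \<in> pverts \<Gamma>.
     (f u, f v) \<in> parcs \<Gamma> \<longleftrightarrow> (u, v) \<in> parcs \<Gamma>}"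

definition AutGroup :: "'a pair_pre_digraph \<Rightarrow> ('a \<Rightarrow> 'a) monoid" where
  "AutGroup \<Gamma> = (BijGroup (pverts \<Gamma>)) \<lparr> carrier := Aut \<Gamma> \<rparr>"

definition rho :: "nat \<Rightarrow> int \<Rightarrow> int" where
  "rho n = (\<lambda>i \<in> Zn n. (i + 1) mod int n)"

definition rho_group :: "nat \<Rightarrow> (int \<Rightarrow> int) set" where
  "rho_group n = generate (BijGroup (Zn n)) {rho n}"

definition Nor :: "nat \<Rightarrow> int pair_pre_digraph set" where
  "Nor n = {\<Gamma> \<in> Circulants n. rho_group n \<lhd> AutGroup \<Gamma>}"

definition NonNor :: "nat \<Rightarrow> int pair_pre_digraph set" where
  "NonNor n = {\<Gamma> \<in> Circulants n. \<not> rho_group n \<lhd> AutGroup \<Gamma>}"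

definition DRR :: "nat \<Rightarrow> int pair_pre_digraph set" where
  "DRR n = {\<Gamma> \<in> Circulants n. Aut \<Gamma> = rho_group n}"

definition admissible_orders :: "nat \<Rightarrow> nat set" where
  "admissible_orders r = {n. \<exists>p e :: nat \<Rightarrow> nat.
     inj_on p {1..r} \<and>
     (\<forall>i \<in> {1..r}. prime (p i) \<and> odd (p i) \<and> e i \<ge> 1) \<and>
     n = 2 * (\<Prod>i = 1..r. p i ^ e i)}"

lemma inj_on_circulant:
  assumes "n > 0"
  shows "inj_on (circulant n) (Pow (Zn n - {0}))"
proof (rule inj_onI)
  fix S T
  assume S: "S \<in> Pow (Zn n - {0})" and T: "T \<in> Pow (Zn n - {0})"
    and eq: "circulant n S = circulant n T"
  have "x \<in> A \<longleftrightarrow> (x, 0) \<in> parcs (circulant n A) \<and> x \<in> Zn n" if "A \<in> Pow (Zn n - {0})" for x A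
    using that assms by (auto simp: circulant_def Zn_def)
  then show "S = T" using S T eq by (metis subsetI subset_antisym)
qed

lemma group_AutGroup: "group (AutGroup \<Gamma>)"
proof -
  let ?V = "pverts \<Gamma>"
  interpret B: group "BijGroup ?V" by (rule group_BijGroup)
  have "subgroup (Aut \<Gamma>) (BijGroup ?V)"
  proof (rule B.subgroupI)
    show "Aut \<Gamma> \<subseteq> carrier (BijGroup ?V)" by (auto simp: Aut_def BijGroup_def)
    have "(\<lambda>x \<in> ?V. x) \<in> Aut \<Gamma>" by (simp add: Aut_def id_Bij)
    then show "Aut \<Gamma> \<noteq> {}" by blast
  next
    fix f assume f: "f \<in> Aut \<Gamma>"
    then have fB: "f \<in> Bij ?V" and bij: "bij_betw f ?V ?V" by (auto simp: Aut_def Bij_def)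
    have "\<forall>u \<in> ?V. inv_into ?V f u \<in> ?V \<and> f (inv_into ?V f u) = u"
      using bij by (metis bij_betw_def f_inv_into_f inv_into_into)
    then show "inv\<^bsub>BijGroup ?V\<^esub> f \<in> Aut \<Gamma>"
      using f restrict_inv_into_Bij[OF fB]
      by (simp add: inv_BijGroup[OF fB] Aut_def) metis
  next
    fix f g assume f: "f \<in> Aut \<Gamma>" and g: "g \<in> Aut \<Gamma>"
    then have "f \<in> Bij ?V" "g \<in> Bij ?V" by (auto simp: Aut_def)
    moreover from this have "\<forall>u \<in> ?V. g u \<in> ?V" by (auto dest: Bij_imp_funcset)
    ultimately show "f \<otimes>\<^bsub>BijGroup ?V\<^esub> g \<in> Aut \<Gamma>"
      using f g by (auto simp: BijGroup_def Aut_def compose_Bij compose_eq)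
  qed
  then show ?thesis unfolding AutGroup_def by (rule B.subgroup_imp_group)
qed

lemma rho_in_Aut:
  assumes "n > 0"
  shows "rho n \<in> Aut (circulant n S)"
proof -
  let ?N = "int n"
  have inj: "inj_on (rho n) (Zn n)"
  proof (rule inj_onI)
    fix x y assume xy: "x \<in> Zn n" "y \<in> Zn n" and "rho n x = rho n y"
    then have "(x + 1) mod ?N = (y + 1) mod ?N" by (simp add: rho_def)
    then have "(x + 1 - 1) mod ?N = (y + 1 - 1) mod ?N" by (rule mod_diff_cong) simp
    then show "x = y" using xy by (simp add: Zn_def)
  qed
  have im: "rho n ` Zn n \<subseteq> Zn n" using assms by (auto simp: rho_def Zn_def)
  have "rho n ` Zn n = Zn n" by (rule endo_inj_surj[OF _ im inj]) (simp add: Zn_def)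
  with inj have "rho n \<in> Bij (Zn n)"
    by (simp add: Bij_def bij_betw_def) (simp add: rho_def)
  moreover have "((u + 1) mod ?N - (v + 1) mod ?N) mod ?N = (u - v) mod ?N" for u v
    by (simp add: mod_diff_eq)
  ultimately show ?thesis
    using im by (auto simp: Aut_def circulant_def rho_def)
qed

end

theory Submission
  imports Defs "HOL-Number_Theory.Number_Theory"
begin

text \<open>
  Write \<open>n = 2m\<close> with \<open>m\<close> odd, let \<open>p\<close> be the least prime divisor of \<open>m\<close>, and put
  \<open>M = m + m / p - 1\<close>. A normal circulant that is not a DRR has a connection set invariant under
  a nontrivial multiplier \<open>a\<close>, which fixes at most \<open>n / p - 1\<close> nonzero residues. If \<open>a\<close> is an
  involution, it therefore has at most \<open>M\<close> orbits on the nonzero residues; if \<open>a\<close> has odd order,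
  its nontrivial orbits have length at least three and it has at most \<open>M - n / 9\<close> orbits. There
  are at most \<open>2\<^sup>r - 1\<close> involutions, so for large \<open>n\<close> there are at most \<open>2\<^sup>r 2\<^sup>M\<close> such
  circulants. On the other hand, the connection sets whose odd part is invariant under translation
  by \<open>n / p\<close> number exactly \<open>2\<^sup>M\<close>, and all of them give non-normal circulants. Thus the ratio is
  eventually at least \<open>1 / 2\<^sup>r\<close>, which is at least \<open>1 / (4 (2\<^sup>r - 1))\<close>.
\<close>

subsection \<open>Normality\<close>

text \<open>Shifts range over all integers, so that composing translations adds shifts and inverting
  negates them; the restriction gives the extensional form that \<open>Bij\<close> demands.\<close>

definition transl :: "nat \<Rightarrow> int \<Rightarrow> int \<Rightarrow> int" where
  "transl n k = (\<lambda>x \<in> Zn n. (x + k) mod int n)"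

lemma pverts_circulant [simp]: "pverts (circulant n S) = Zn n"
  by (simp add: circulant_def)

lemma arc_circulant_iff:
  "(u, v) \<in> parcs (circulant n S) \<longleftrightarrow> u \<in> Zn n \<and> v \<in> Zn n \<and> (u - v) mod int n \<in> S"
  by (simp add: circulant_def)

lemma mod_in_Zn [simp]: "n > 0 \<Longrightarrow> x mod int n \<in> Zn n"
  by (simp add: Zn_def)

lemma mod_Zn [simp]: "x \<in> Zn n \<Longrightarrow> x mod int n = x"
  by (simp add: Zn_def)

lemma finite_Zn [simp]: "finite (Zn n)"
  by (simp add: Zn_def)

lemma card_Zn_minus_0: "n > 0 \<Longrightarrow> card (Zn n - {0}) = n - 1"
  by (simp add: Zn_def)

lemma Aut_circulant_iff:
  assumes "n > 0"
  shows "f \<in> Aut (circulant n S) \<longleftrightarrow> f \<in> Bij (Zn n) \<and>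
    (\<forall>u \<in> Zn n. \<forall>v \<in> Zn n. (f u - f v) mod int n \<in> S \<longleftrightarrow> (u - v) mod int n \<in> S)"
proof (cases "f \<in> Bij (Zn n)")
  case True
  then have "f u \<in> Zn n" if "u \<in> Zn n" for u using that by (auto dest: Bij_imp_funcset)
  with True show ?thesis by (simp add: Aut_def arc_circulant_iff)
qed (simp add: Aut_def)

lemma Bij_ZnI:
  assumes "f \<in> extensional (Zn n)" "\<And>x. x \<in> Zn n \<Longrightarrow> f x \<in> Zn n" "inj_on f (Zn n)"
  shows "f \<in> Bij (Zn n)"
  using assms endo_inj_surj[of "Zn n" f] by (auto simp: Bij_def bij_betw_def)

lemma transl_Bij:
  assumes "n > 0"
  shows "transl n k \<in> Bij (Zn n)"
proof (rule Bij_ZnI)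
  show "inj_on (transl n k) (Zn n)"
  proof (rule inj_onI)
    fix x y assume xy: "x \<in> Zn n" "y \<in> Zn n" and "transl n k x = transl n k y"
    then have "(x + k) mod int n = (y + k) mod int n" by (simp add: transl_def)
    then have "(x + k - k) mod int n = (y + k - k) mod int n" by (rule mod_diff_cong) simp
    then show "x = y" using xy by simp
  qed
qed (use assms in \<open>auto simp: transl_def\<close>)

lemma transl_in_Aut:
  assumes "n > 0"
  shows "transl n k \<in> Aut (circulant n S)"
  using assms by (simp add: Aut_circulant_iff transl_Bij) (simp add: transl_def mod_diff_eq)

lemma compose_transl:
  "n > 0 \<Longrightarrow> compose (Zn n) (transl n a) (transl n b) = transl n (a + b)"
  by (auto simp: compose_def transl_def mod_simps algebra_simps intro!: restrict_ext)

lemma transl_0: "transl n 0 = (\<lambda>x \<in> Zn n. x)"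
  by (auto simp: transl_def)

lemma rho_eq_transl: "rho n = transl n 1"
  by (simp add: rho_def transl_def)

lemma transl_mod: "transl n (k mod int n) = transl n k"
  by (auto simp: transl_def mod_simps intro!: restrict_ext)

lemma rho_group_eq:
  assumes "n > 0"
  shows "rho_group n = range (transl n)"
proof
  let ?G = "BijGroup (Zn n)"
  interpret B: group ?G by (rule group_BijGroup)
  have mult: "transl n a \<otimes>\<^bsub>?G\<^esub> transl n b = transl n (a + b)" for a b
    using assms by (simp add: BijGroup_def transl_Bij compose_transl)
  have inv: "inv\<^bsub>?G\<^esub> (transl n a) = transl n (- a)" for a
    by (rule B.inv_equality) (use assms in \<open>simp_all only: mult, simp_all add: BijGroup_def transl_Bij transl_0\<close>)
  show "rho_group n \<subseteq> range (transl n)"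
  proof
    fix f assume "f \<in> rho_group n"
    then have "f \<in> generate ?G {rho n}" by (simp add: rho_group_def)
    then show "f \<in> range (transl n)"
    proof induction
      case one
      then show ?case by (simp add: BijGroup_def transl_0[symmetric])
    next
      case (eng h1 h2)
      then show ?case by (auto simp: mult)
    qed (auto simp: rho_eq_transl inv)
  qed
  show "range (transl n) \<subseteq> rho_group n"
  proof
    fix f assume "f \<in> range (transl n)"
    then obtain k where k: "f = transl n k" by blast
    \<comment> \<open>Induction reaches only natural shifts; an arbitrary integer shift is then
      replaced by its residue.\<close>
    have "transl n (int j) \<in> generate ?G {rho n}" for j
    proof (induction j)
      case 0
      then show ?case using generate.one[of ?G "{rho n}"] by (simp add: BijGroup_def transl_0[symmetric])
    next
      case (Suc j)
      have "transl n 1 \<in> generate ?G {rho n}"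
        by (rule generate.incl) (simp add: rho_eq_transl)
      from generate.eng[OF this Suc] show ?case by (simp add: mult)
    qed
    from this[of "nat (k mod int n)"] show "f \<in> rho_group n"
      using assms by (simp add: k rho_group_def transl_mod)
  qed
qed

text \<open>For a cyclic subgroup it suffices to conjugate the generator: the pointwise equation is
  \<open>f\<close> after \<open>rho\<close> equal to the \<open>k\<close>-th power of
  \<open>rho\<close> after \<open>f\<close>. Normality thus becomes a recurrence that forces
  \<open>f\<close> to be affine.\<close>

lemma normal_circulant_iff:
  assumes "n > 0"
  shows "rho_group n \<lhd> AutGroup (circulant n S) \<longleftrightarrow>
    (\<forall>f \<in> Aut (circulant n S). \<exists>k. \<forall>x \<in> Zn n. f ((x + 1) mod int n) = (f x + k) mod int n)"
    (is "?l \<longleftrightarrow> ?r")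
proof
  let ?\<Gamma> = "circulant n S"
  let ?A = "AutGroup ?\<Gamma>"
  interpret A: group ?A by (rule group_AutGroup)
  have car: "carrier ?A = Aut ?\<Gamma>" by (simp add: AutGroup_def)
  have Bij: "f \<in> Bij (Zn n)" if "f \<in> Aut ?\<Gamma>" for f using that by (simp add: Aut_def)
  have mult: "f \<otimes>\<^bsub>?A\<^esub> g = compose (Zn n) f g" if "f \<in> Aut ?\<Gamma>" "g \<in> Aut ?\<Gamma>" for f g
    using Bij[OF that(1)] Bij[OF that(2)] by (simp add: AutGroup_def BijGroup_def)
  have tA: "transl n k \<in> Aut ?\<Gamma>" for k by (rule transl_in_Aut[OF assms])
  have one: "\<one>\<^bsub>?A\<^esub> = transl n 0" by (simp add: AutGroup_def BijGroup_def transl_0)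
  have inv: "inv\<^bsub>?A\<^esub> (transl n a) = transl n (- a)" for a
    by (rule A.inv_equality) (simp_all add: mult car tA compose_transl assms one)
  {
    assume n: ?l
    show ?r
    proof
      fix f assume f: "f \<in> Aut ?\<Gamma>"
      have "f \<otimes>\<^bsub>?A\<^esub> transl n 1 \<in> f <#\<^bsub>?A\<^esub> rho_group n"
        by (auto simp: l_coset_def rho_group_eq assms)
      also have "\<dots> = rho_group n #>\<^bsub>?A\<^esub> f"
        using n f by (simp add: normal.coset_eq car)
      finally obtain k where "f \<otimes>\<^bsub>?A\<^esub> transl n 1 = transl n k \<otimes>\<^bsub>?A\<^esub> f"
        by (auto simp: r_coset_def rho_group_eq assms)
      then have eq: "compose (Zn n) f (transl n 1) = compose (Zn n) (transl n k) f"
        by (simp add: mult f tA)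
      have "f ((x + 1) mod int n) = (f x + k) mod int n" if "x \<in> Zn n" for x
      proof -
        have "f x \<in> Zn n" using Bij[OF f] that by (auto dest: Bij_imp_funcset)
        with fun_cong[OF eq, of x] that show ?thesis by (simp add: compose_def transl_def)
      qed
      then show "\<exists>k. \<forall>x \<in> Zn n. f ((x + 1) mod int n) = (f x + k) mod int n" by blast
    qed
  next
    assume r: ?r
    have sub: "subgroup (rho_group n) ?A"
    proof (rule A.subgroupI)
      fix f g assume "f \<in> rho_group n" "g \<in> rho_group n"
      then show "f \<otimes>\<^bsub>?A\<^esub> g \<in> rho_group n"
        by (auto simp: rho_group_eq assms mult tA compose_transl)
    qed (auto simp: rho_group_eq assms car tA inv)
    show ?l
    proof (rule A.normal_invI[OF sub])
      fix f h assume f: "f \<in> carrier ?A" and "h \<in> rho_group n"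
      then obtain j' where "h = transl n j'" by (auto simp: rho_group_eq assms)
      \<comment> \<open>A natural shift makes the induction in \<open>shift\<close>
        applicable.\<close>
      then have h: "h = transl n (int (nat (j' mod int n)))" using assms by (simp add: transl_mod)
      define j where "j = nat (j' mod int n)"
      from r f obtain k where k: "\<And>x. x \<in> Zn n \<Longrightarrow> f ((x + 1) mod int n) = (f x + k) mod int n"
        by (auto simp: car)
      have fZ: "f x \<in> Zn n" if "x \<in> Zn n" for x
        using Bij f that by (auto simp: car dest: Bij_imp_funcset)
      have shift: "f ((x + int j) mod int n) = (f x + int j * k) mod int n" if "x \<in> Zn n" for x j
      proof (induction j)
        case 0
        then show ?case using that fZ by simp
      next
        case (Suc j)
        have "(x + int (Suc j)) mod int n = ((x + int j) mod int n + 1) mod int n"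
          by (simp add: mod_simps algebra_simps)
        with k[of "(x + int j) mod int n"] assms
        have "f ((x + int (Suc j)) mod int n) = (f ((x + int j) mod int n) + k) mod int n" by simp
        then show ?case unfolding Suc by (simp add: mod_simps algebra_simps)
      qed
      have "compose (Zn n) f h = compose (Zn n) (transl n (int j * k)) f"
        unfolding h j_def[symmetric] using shift fZ
        by (auto simp: compose_def transl_def intro!: restrict_ext)
      then have "f \<otimes>\<^bsub>?A\<^esub> h = transl n (int j * k) \<otimes>\<^bsub>?A\<^esub> f"
        using f by (simp add: mult car tA h)
      then have "f \<otimes>\<^bsub>?A\<^esub> h \<otimes>\<^bsub>?A\<^esub> inv\<^bsub>?A\<^esub> f = transl n (int j * k)"
        using f by (simp add: A.m_assoc car tA A.r_inv[unfolded car] A.inv_closed[unfolded car] A.r_one[unfolded car])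
      then show "f \<otimes>\<^bsub>?A\<^esub> h \<otimes>\<^bsub>?A\<^esub> inv\<^bsub>?A\<^esub> f \<in> rho_group n"
        by (simp add: rho_group_eq assms)
    qed
  }
qed

text \<open>In the normal case, an automorphism is affine; composing it with a translation yields
  a multiplier of the connection set.\<close>

lemma normal_not_DRR_multiplier:
  assumes "n > 0" and nor: "circulant n S \<in> Nor n - DRR n"
  obtains a where "1 < a" "a < int n" "coprime a (int n)"
    "\<forall>x \<in> Zn n. a * x mod int n \<in> S \<longleftrightarrow> x \<in> S"
proof -
  let ?A = "Aut (circulant n S)"
  have "\<not> ?A \<subseteq> rho_group n"
    using nor transl_in_Aut[OF assms(1), of _ S] by (auto simp: Nor_def DRR_def rho_group_eq assms(1))
  then obtain f where f: "f \<in> ?A" "f \<notin> range (transl n)"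
    by (auto simp: rho_group_eq assms(1))
  from nor f(1) obtain k where k: "\<And>x. x \<in> Zn n \<Longrightarrow> f ((x + 1) mod int n) = (f x + k) mod int n"
    by (auto simp: Nor_def normal_circulant_iff assms(1))
  have fB: "f \<in> Bij (Zn n)" using f by (simp add: Aut_circulant_iff assms(1))
  then have fZ: "f x \<in> Zn n" if "x \<in> Zn n" for x
    using that by (auto dest: Bij_imp_funcset)
  have Z0: "0 \<in> Zn n" using assms(1) by (simp add: Zn_def)
  have fj: "f (int j) = (f 0 + k * int j) mod int n" if "j < n" for j
    using that
  proof (induction j)
    case 0
    then show ?case using fZ[OF Z0] by simp
  next
    case (Suc j)
    then have "int j \<in> Zn n" by (simp add: Zn_def)
    from k[OF this] Suc show ?case by (simp add: mod_simps algebra_simps)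
  qed
  have fx: "f x = (f 0 + k * x) mod int n" if "x \<in> Zn n" for x
    using fj[of "nat x"] that by (auto simp: Zn_def nat_less_iff)
  define a where "a = k mod int n"
  have inv: "a * x mod int n \<in> S \<longleftrightarrow> x \<in> S" if "x \<in> Zn n" for x
  proof -
    have "(f x - f 0) mod int n = a * x mod int n"
      by (simp add: fx[OF that] a_def mod_simps)
    moreover have "(f x - f 0) mod int n \<in> S \<longleftrightarrow> (x - 0) mod int n \<in> S"
      using f(1) that Z0 Aut_circulant_iff[OF assms(1)] by blast
    ultimately show ?thesis using that by simp
  qed
  \<comment> \<open>Surjectivity makes the slope invertible: a preimage \<open>x\<close> of
    \<open>f 0 + 1\<close> satisfies \<open>k * x = 1\<close> modulo \<open>n\<close>.\<close>
  have "(f 0 + 1) mod int n \<in> f ` Zn n"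
    using fB assms(1) by (simp add: Bij_def bij_betw_def)
  then obtain x where "x \<in> Zn n" "(f 0 + k * x) mod int n = (f 0 + 1) mod int n"
    using fx by auto
  then have "[f 0 + k * x = f 0 + 1] (mod int n)" by (simp add: cong_def)
  then have "[k * x = 1] (mod int n)" by (simp only: cong_add_lcancel)
  then have "coprime k (int n)" using coprime_iff_invertible_int by blast
  then have cop: "coprime a (int n)" using assms(1) by (simp add: a_def)
  have ne1: "a \<noteq> 1"
  proof
    assume "a = 1"
    have "f x = transl n (f 0) x" for x
    proof (cases "x \<in> Zn n")
      case True
      have "f x = (f 0 + a * x) mod int n" unfolding fx[OF True] a_def
        by (rule mod_add_cong) (simp_all add: mod_simps)
      with True \<open>a = 1\<close> show ?thesis by (simp add: transl_def add.commute)
    next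
      case False
      with fB show ?thesis by (simp add: transl_def Bij_def extensional_def)
    qed
    with f(2) show False by blast
  qed
  \<comment> \<open>Modulo 1 even 0 is a unit, so coprimality excludes \<open>a = 0\<close> only
    once this case is gone.\<close>
  have "n \<noteq> 1"
  proof
    assume "n = 1"
    then have "Zn n = {0}" by (auto simp: Zn_def)
    then have "f x = transl n 0 x" for x
      using fB fZ by (cases "x = 0") (auto simp: transl_def Bij_def extensional_def)
    with f(2) show False by blast
  qed
  then have "a \<noteq> 0" using cop assms(1) by auto
  moreover have "0 \<le> a" "a < int n" using assms(1) by (simp_all add: a_def)
  ultimately show thesis using that[OF _ _ cop] inv ne1 by auto
qed

subsection \<open>Orbits of multipliers\<close>

text \<open>A saturated set is the union of the classes it contains, so recording those classes is
  injective.\<close>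

lemma card_saturated_le:
  assumes "finite X" "equiv X R"
  shows "card {S. S \<subseteq> X \<and> (\<forall>(x, y) \<in> R. x \<in> S \<longrightarrow> y \<in> S)} \<le> 2 ^ card (X // R)"
    (is "card ?Sat \<le> _")
proof -
  have fin: "finite (X // R)" using assms(1) by (simp add: quotient_def)
  have un: "S = \<Union>{C \<in> X // R. C \<subseteq> S}" if "S \<in> ?Sat" for S
  proof
    show "S \<subseteq> \<Union>{C \<in> X // R. C \<subseteq> S}"
    proof
      fix x assume x: "x \<in> S"
      with that have "x \<in> X" by auto
      then have "R `` {x} \<in> X // R" "x \<in> R `` {x}"
        by (rule quotientI, rule equiv_class_self[OF assms(2)])
      moreover have "R `` {x} \<subseteq> S" using that x by auto
      ultimately show "x \<in> \<Union>{C \<in> X // R. C \<subseteq> S}" by blast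
    qed
  qed auto
  have "card ?Sat \<le> card (Pow (X // R))"
  proof (rule card_inj_on_le)
    show "inj_on (\<lambda>S. {C \<in> X // R. C \<subseteq> S}) ?Sat"
    proof (rule inj_onI)
      fix S T assume "S \<in> ?Sat" "T \<in> ?Sat" "{C \<in> X // R. C \<subseteq> S} = {C \<in> X // R. C \<subseteq> T}"
      then show "S = T" using un[of S] un[of T] by simp
    qed
  qed (use fin in auto)
  then show ?thesis using fin by (simp add: card_Pow)
qed

text \<open>At most \<open>card F\<close> classes meet \<open>F\<close>, each with at least one
  element; every other class has at least \<open>l\<close>. Counting \<open>X\<close> class by class
  gives the bound, stated without division.\<close>

lemma card_quotient_le:
  fixes l :: nat
  assumes "finite X" "equiv X R" "F \<subseteq> X" "l \<ge> 1"
    and large: "\<And>x. x \<in> X - F \<Longrightarrow> l \<le> card (R `` {x})"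
  shows "l * card (X // R) \<le> card X + (l - 1) * card F"
proof -
  define B where "B = {C \<in> X // R. C \<inter> F = {}}"
  define G where "G = {C \<in> X // R. C \<inter> F \<noteq> {}}"
  have fin: "finite (X // R)" using assms(1) by (simp add: quotient_def)
  have BG: "X // R = B \<union> G" "B \<inter> G = {}" "finite B" "finite G"
    using fin by (auto simp: B_def G_def)
  have finF: "finite F" using assms finite_subset by blast
  have Xfin: "finite C" "C \<noteq> {}" if "C \<in> X // R" for C
    using in_quotient_imp_non_empty[OF assms(2) that]
      finite_subset[OF in_quotient_imp_subset[OF assms(2) that] assms(1)] by auto
  have "G \<subseteq> (\<lambda>x. R `` {x}) ` F"
  proof
    fix C assume C: "C \<in> G"
    then obtain x where "x \<in> C" "x \<in> F" "C \<in> X // R" by (auto simp: G_def)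
    then obtain y where y: "C = R `` {y}" by (auto elim: quotientE)
    with \<open>x \<in> C\<close> have "(y, x) \<in> R" by simp
    with y have "C = R `` {x}" using equiv_class_eq[OF assms(2)] by simp
    with \<open>x \<in> F\<close> show "C \<in> (\<lambda>x. R `` {x}) ` F" by blast
  qed
  then have G: "card G \<le> card F" using finF by (rule surj_card_le[rotated])
  have "l \<le> card C" if "C \<in> B" for C
  proof -
    from that obtain x where x: "x \<in> X" "C = R `` {x}" by (auto simp: B_def elim: quotientE)
    then have "x \<in> C" using equiv_class_self[OF assms(2)] by blast
    with that x have "x \<in> X - F" by (auto simp: B_def)
    from large[OF this] x show ?thesis by simp
  qed
  then have "l * card B \<le> (\<Sum>C\<in>B. card C)"
    using sum_bounded_below[of B l card] by (simp add: mult.commute)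
  moreover have "1 \<le> card C" if "C \<in> G" for C
    using Xfin[of C] that by (auto simp: G_def Suc_le_eq card_gt_0_iff)
  then have "card G \<le> (\<Sum>C\<in>G. card C)"
    using sum_bounded_below[of G 1 card] by simp
  moreover have "card X = (\<Sum>C\<in>X // R. card C)"
    unfolding card_eq_sum by (rule sum.partition[OF assms(1) partition_on_quotient[OF assms(2)]])
  then have "card X = (\<Sum>C\<in>B. card C) + (\<Sum>C\<in>G. card C)"
    using BG by (simp add: sum.union_disjoint)
  ultimately have "l * card B + card G \<le> card X" by simp
  moreover have "card (X // R) = card B + card G"
    using BG by (simp add: card_Un_disjoint)
  moreover have "l * card G = card G + (l - 1) * card G"
    using assms(4) by (cases l) auto
  moreover have "(l - 1) * card G \<le> (l - 1) * card F" using G by (rule mult_left_mono) simp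
  ultimately show ?thesis by (simp only: distrib_left)
qed

section \<open>Connection sets invariant under a multiplier\<close>

definition mult_invariant :: "nat \<Rightarrow> int \<Rightarrow> int set set" where
  "mult_invariant n a = {S. S \<subseteq> Zn n - {0} \<and> (\<forall>x \<in> Zn n. a * x mod int n \<in> S \<longleftrightarrow> x \<in> S)}"

lemma mult_invariant_power:
  assumes "S \<in> mult_invariant n a" "n > 0"
  shows "S \<in> mult_invariant n (a ^ i mod int n)"
proof -
  have "a ^ i * x mod int n \<in> S \<longleftrightarrow> x \<in> S" if "x \<in> Zn n" for x
  proof (induction i)
    case (Suc i)
    have "a ^ Suc i * x mod int n = a * (a ^ i * x mod int n) mod int n"
      by (simp add: mod_simps mult.assoc)
    with assms Suc show ?case by (simp add: mult_invariant_def)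
  qed (simp add: that)
  with assms(1) show ?thesis by (simp add: mult_invariant_def mod_simps)
qed

lemma finite_mult_invariant: "finite (mult_invariant n a)"
  by (rule finite_subset[of _ "Pow (Zn n)"]) (auto simp: mult_invariant_def)

lemma power_mod_one:
  assumes "coprime a (int n)" "n > 1"
  obtains N where "N > 0" "[a ^ N = 1] (mod int n)"
proof (rule that)
  show "totient n > 0" using assms by simp
  show "[a ^ totient n = 1] (mod int n)"
    using residues.euler_theorem[of "int n" a] assms by (simp add: residues_def)
qed

text \<open>The classes of \<open>R\<close> are the orbits of the powers of \<open>a\<close> on the
  nonzero residues, and invariant sets are saturated. The witness is the number of orbits; hiding it
  leaves later bounds purely arithmetical.\<close>

lemma card_mult_invariant_le:
  fixes l :: nat
  assumes a: "coprime a (int n)" and n: "n > 1" and l: "l \<ge> 1"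
    and large: "\<And>x. x \<in> Zn n \<Longrightarrow> a * x mod int n \<noteq> x \<Longrightarrow>
      l \<le> card {a ^ i * x mod int n |i. True}"
  shows "\<exists>N. card (mult_invariant n a) \<le> 2 ^ N \<and>
    l * N \<le> (n - 1) + (l - 1) * card {x \<in> Zn n - {0}. a * x mod int n = x}"
proof -
  let ?X = "Zn n - {0}"
  let ?F = "{x \<in> ?X. a * x mod int n = x}"
  define R where "R = {(x, y). x \<in> ?X \<and> (\<exists>i. y = a ^ i * x mod int n)}"
  have closed: "a ^ i * x mod int n \<in> ?X" if x: "x \<in> ?X" for x i
  proof -
    have "\<not> int n dvd a ^ i * x"
    proof
      assume "int n dvd a ^ i * x"
      then have "int n dvd x"
        using a by (simp add: coprime_dvd_mult_right_iff coprime_commute)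
      with x show False by (auto simp: Zn_def dest: zdvd_imp_le)
    qed
    with n show ?thesis by auto
  qed
  obtain N where N: "N > 0" "[a ^ N = 1] (mod int n)" by (rule power_mod_one[OF a n])
  have "equiv ?X R"
  proof (rule equivI)
    show "R \<subseteq> ?X \<times> ?X"
    proof
      fix z assume "z \<in> R"
      then obtain x i where "z = (x, a ^ i * x mod int n)" "x \<in> ?X" by (auto simp: R_def)
      then show "z \<in> ?X \<times> ?X" using closed[of x i] by (simp only: mem_Sigma_iff)
    qed
    show "refl_on ?X R" by (auto simp: refl_on_def R_def intro!: exI[of _ 0])
    show "sym R"
    proof (rule symI)
      fix x y assume "(x, y) \<in> R"
      then obtain i where i: "x \<in> ?X" "y = a ^ i * x mod int n" by (auto simp: R_def)
      \<comment> \<open>Since \<open>a ^ N = 1\<close>, the power \<open>a ^ ((N - 1) * i)\<close>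
        inverts \<open>a ^ i\<close>.\<close>
      have "[a ^ ((N - 1) * i) * (a ^ i * x) = (a ^ N) ^ i * x] (mod int n)"
        using N(1) by (cases N) (simp_all add: power_mult[symmetric] power_add[symmetric] algebra_simps)
      also have "[(a ^ N) ^ i * x = 1 ^ i * x] (mod int n)"
        by (intro cong_mult cong_pow N(2)) simp
      finally have "x = a ^ ((N - 1) * i) * y mod int n"
        using i by (simp add: cong_def mod_simps)
      moreover have "y \<in> ?X" using i closed[of x i] by simp
      ultimately show "(y, x) \<in> R"
        unfolding R_def mem_Collect_eq prod.case by (intro conjI exI)
    qed
    show "trans R"
    proof (rule transI)
      fix x y z assume "(x, y) \<in> R" "(y, z) \<in> R"
      then obtain i j where "x \<in> ?X" "z = a ^ j * (a ^ i * x mod int n) mod int n"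
        by (auto simp: R_def)
      then have "x \<in> ?X" "z = a ^ (j + i) * x mod int n"
        by (auto simp: mod_simps power_add mult.assoc)
      then show "(x, z) \<in> R" unfolding R_def by blast
    qed
  qed
  moreover have "mult_invariant n a \<subseteq> {S. S \<subseteq> ?X \<and> (\<forall>(x, y) \<in> R. x \<in> S \<longrightarrow> y \<in> S)}"
  proof
    fix S assume S: "S \<in> mult_invariant n a"
    have "a ^ i * x mod int n \<in> S" if "x \<in> S" "x \<in> ?X" for x i
      using mult_invariant_power[OF S, of i] n that by (auto simp: mult_invariant_def mod_simps)
    with S show "S \<in> {S. S \<subseteq> ?X \<and> (\<forall>(x, y) \<in> R. x \<in> S \<longrightarrow> y \<in> S)}"
      by (auto simp: mult_invariant_def R_def)
  qed
  ultimately have "card (mult_invariant n a) \<le> 2 ^ card (?X // R)"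
    using card_mono[OF _ \<open>mult_invariant n a \<subseteq> _\<close>] card_saturated_le[of ?X R]
    by (simp add: le_trans)
  moreover have "l * card (?X // R) \<le> card ?X + (l - 1) * card ?F"
  proof (rule card_quotient_le)
    fix x assume x: "x \<in> ?X - ?F"
    then have "R `` {x} = {a ^ i * x mod int n |i. True}" by (auto simp: R_def)
    with x large[of x] show "l \<le> card (R `` {x})" by auto
  qed (use \<open>equiv ?X R\<close> l in auto)
  ultimately show ?thesis using n by (auto simp: card_Zn_minus_0)
qed

text \<open>With \<open>d = gcd (a - 1) n\<close>, fixed residues are multiples of
  \<open>q = n / d\<close>, so at most \<open>d - 1\<close> are nonzero. Both \<open>a - 1\<close>
  and \<open>n\<close> are even, hence so is \<open>d\<close>, and \<open>q\<close> divides
  \<open>m\<close>; as \<open>d \<le> a - 1 < n\<close>, also \<open>q > 1\<close>, whence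
  \<open>p \<le> q\<close>.\<close>

lemma card_fixed_multiplier_le:
  assumes n: "n = 2 * m" "odd m" and p: "\<And>q. q dvd m \<Longrightarrow> q > 1 \<Longrightarrow> p \<le> q" "p > 0"
    and a: "coprime a (int n)" "1 < a" "a < int n"
  shows "card {x \<in> Zn n - {0}. a * x mod int n = x} \<le> n div p - 1"
proof -
  define d where "d = nat (gcd (a - 1) (int n))"
  have dg: "int d = gcd (a - 1) (int n)" by (simp add: d_def)
  have n0: "n > 0" using n by (auto intro!: Nat.gr0I)
  have "even n" using n by simp
  have "odd a" using a(1) n coprime_common_divisor[of a "int n" 2] by auto
  then have "2 dvd gcd (a - 1) (int n)" using n by simp
  then have "even d" using dg by presburger
  then obtain d' where d': "d = 2 * d'" by blast
  have "int d dvd int n" "int d dvd a - 1" by (simp_all add: dg)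
  then obtain q c where q: "n = d * q" and c: "a - 1 = int d * c"
    by (auto elim!: dvdE simp: int_dvd_int_iff)
  have "d > 0" "q > 0" using n0 q by (auto intro!: Nat.gr0I)
  have "m = d' * q" using n q d' by simp
  have "int d \<le> a - 1" using a(2) \<open>int d dvd a - 1\<close> by (intro zdvd_imp_le) auto
  then have "d < n" using a(3) by simp
  then have "q > 1" using q \<open>q > 0\<close> by (cases "q = 1") auto
  then have "p \<le> q" using p \<open>m = d' * q\<close> by simp
  \<comment> \<open>A common factor of \<open>c\<close> and \<open>q\<close> would enlarge the gcd
    \<open>d\<close>.\<close>
  have cop: "coprime c (int q)"
  proof (rule coprimeI)
    fix e assume "e dvd c" "e dvd int q"
    then have "int d * e dvd a - 1" "int d * e dvd int n"
      using c q by (auto intro: mult_dvd_mono)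
    then have "int d * e dvd int d" unfolding dg by (rule gcd_greatest)
    then show "is_unit e" using \<open>d > 0\<close> by simp
  qed
  have "{x \<in> Zn n - {0}. a * x mod int n = x} \<subseteq> (\<lambda>j. int (j * q)) ` {1..<d}"
  proof
    fix x assume "x \<in> {x \<in> Zn n - {0}. a * x mod int n = x}"
    then have x: "0 < x" "x < int n" "a * x mod int n = x" by (auto simp: Zn_def)
    then have "[a * x = x] (mod int n)" by (simp add: cong_def)
    then have "int n dvd (a - 1) * x" by (simp add: cong_iff_dvd_diff algebra_simps)
    then have "int d * int q dvd int d * (c * x)" by (simp add: c q mult.assoc)
    then have "int q dvd x" using cop \<open>d > 0\<close>
      by (simp add: coprime_dvd_mult_right_iff coprime_commute)
    then obtain j where j: "x = int q * j" by blast
    have "j > 0" using x(1) \<open>q > 0\<close> unfolding j by (simp add: zero_less_mult_iff)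
    moreover have "int q * j < int q * int d" using x(2) unfolding j q by (simp add: mult.commute)
    then have "j < int d" using \<open>q > 0\<close> by simp
    ultimately have "nat j \<in> {1..<d}" "x = int (nat j * q)" by (auto simp: j mult.commute)
    then show "x \<in> (\<lambda>j. int (j * q)) ` {1..<d}" by blast
  qed
  then have "card {x \<in> Zn n - {0}. a * x mod int n = x} \<le> card {1..<d}"
    by (rule surj_card_le[rotated]) simp
  also have "\<dots> = d - 1" by simp
  also have "d = n div q" using q \<open>q > 0\<close> by simp
  also have "n div q - 1 \<le> n div p - 1" using \<open>p \<le> q\<close> p(2) by (intro diff_le_mono div_le_mono2) auto
  finally show ?thesis .
qed

subsection \<open>Normal circulants that are not DRRs\<close>

text \<open>Thus \<open>p\<close> is the least prime divisor of \<open>m\<close>; minimality is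
  phrased over all divisors above 1 because it is applied to a possibly composite one.\<close>

locale twice_odd =
  fixes n m p :: nat
  assumes n: "n = 2 * m" and odd: "odd m"
    and p: "p dvd m" "p > 1" and p_least: "\<And>q. q dvd m \<Longrightarrow> q > 1 \<Longrightarrow> p \<le> q"
begin

text \<open>Half of \<open>(n - 1) + (n / p - 1)\<close>: the orbit bound when
  \<open>n / p - 1\<close> residues are fixed and the others come in pairs.\<close>

definition M :: nat where "M = m + m div p - 1"

lemma p_ge_3: "p \<ge> 3"
proof -
  have "odd p" using odd p(1) by (metis dvd_trans)
  with p(2) show ?thesis by (cases "p = 2") auto
qed

lemma m_ge_3: "m \<ge> 3"
  using p_ge_3 p(1) odd by (metis dvd_imp_le even_zero gr0I le_trans)

lemma n_pos: "n > 0" "n > 1"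
  using m_ge_3 by (simp_all add: n)

lemma n_div_p: "n div p = 2 * (m div p)"
  using p by (auto simp: n)

lemma div_p_bounds: "1 \<le> m div p" "3 * (m div p) \<le> m"
proof -
  obtain k where k: "m = p * k" using p(1) by blast
  then have "m div p = k" using p(2) by simp
  moreover have "k > 0" using k m_ge_3 by (auto intro!: Nat.gr0I)
  ultimately show "1 \<le> m div p" "3 * (m div p) \<le> m" using k p_ge_3 by simp_all
qed

text \<open>A moved residue shares its orbit with its image, so \<open>l = 2\<close> applies; the
  resulting right-hand side is exactly \<open>2 * M\<close>.\<close>

lemma card_mult_invariant_involution_le:
  assumes a: "coprime a (int n)" "1 < a" "a < int n"
  shows "card (mult_invariant n a) \<le> 2 ^ M"
proof -
  have "\<exists>N. card (mult_invariant n a) \<le> 2 ^ N \<and>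
    2 * N \<le> (n - 1) + (2 - 1) * card {x \<in> Zn n - {0}. a * x mod int n = x}"
  proof (rule card_mult_invariant_le[OF a(1)])
    fix x assume x: "x \<in> Zn n" "a * x mod int n \<noteq> x"
    have "{a ^ 0 * x mod int n, a ^ 1 * x mod int n} \<subseteq> {a ^ i * x mod int n |i. True}"
      by blast
    moreover have "finite {a ^ i * x mod int n |i. True}"
      by (rule finite_subset[of _ "Zn n"]) (auto simp: n_pos)
    ultimately have "card {a ^ 0 * x mod int n, a ^ 1 * x mod int n} \<le> card {a ^ i * x mod int n |i. True}"
      by (rule card_mono[rotated])
    then show "2 \<le> card {a ^ i * x mod int n |i. True}" using x by simp
  qed (use n_pos in auto)
  then obtain N where N: "card (mult_invariant n a) \<le> 2 ^ N"
    "2 * N \<le> (n - 1) + card {x \<in> Zn n - {0}. a * x mod int n = x}" by auto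
  have "2 * N \<le> (n - 1) + (n div p - 1)"
    using N(2) card_fixed_multiplier_le[OF n odd p_least _ a] p(2) by fastforce
  then have "N \<le> M" using div_p_bounds m_ge_3 by (simp add: n_div_p M_def) (simp add: n)
  then have "(2 :: nat) ^ N \<le> 2 ^ M" by simp
  with N(1) show ?thesis by (rule le_trans)
qed

text \<open>If \<open>a ^ 2 * x = x\<close>, the odd exponent \<open>N\<close> yields
  \<open>a * x = x\<close>. So the orbit of a moved residue has at least three elements, which saves
  \<open>n div 9\<close> in the exponent.\<close>

lemma card_mult_invariant_odd_order_le:
  assumes a: "coprime a (int n)" "1 < a" "a < int n"
    and N: "[a ^ N = 1] (mod int n)" "odd N"
  shows "card (mult_invariant n a) * 2 ^ (n div 9) \<le> 2 ^ M"
proof -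
  have "\<exists>N. card (mult_invariant n a) \<le> 2 ^ N \<and>
    3 * N \<le> (n - 1) + (3 - 1) * card {x \<in> Zn n - {0}. a * x mod int n = x}"
  proof (rule card_mult_invariant_le[OF a(1)])
    fix x assume x: "x \<in> Zn n" "a * x mod int n \<noteq> x"
    let ?x = "\<lambda>i. a ^ i * x mod int n"
    have step: "[a ^ (i + 2) * x = a ^ i * x] (mod int n)" if "[a ^ 2 * x = x] (mod int n)" for i
      using cong_mult[OF cong_refl[of "a ^ i"] that] by (simp only: power_add mult.assoc)
    have "?x 2 \<noteq> x"
    proof
      assume "?x 2 = x"
      with x(1) have 2: "[a ^ 2 * x = x] (mod int n)" by (simp add: cong_def)
      have even: "[a ^ (2 * j) * x = x] (mod int n)" for j
      proof (induction j)
        case (Suc j)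
        have "[a ^ (2 * j + 2) * x = a ^ (2 * j) * x] (mod int n)" by (rule step[OF 2])
        from cong_trans[OF this Suc] show ?case by simp
      qed simp
      obtain j where j: "N = 2 * j + 1" using N(2) by (rule oddE)
      have "[a * x = a * (a ^ (2 * j) * x)] (mod int n)"
        by (intro cong_mult cong_refl cong_sym[OF even])
      also have "a * (a ^ (2 * j) * x) = a ^ N * x" by (simp add: j mult.assoc)
      also have "[a ^ N * x = 1 * x] (mod int n)" by (intro cong_mult N(1) cong_refl)
      finally show False using x by (simp add: cong_def)
    qed
    moreover have "?x 2 \<noteq> ?x 1"
    proof
      assume "?x 2 = ?x 1"
      then have "[a * (a * x) = a * x] (mod int n)" by (simp add: cong_def power2_eq_square mult.assoc)
      then have "[a * x = x] (mod int n)" using a(1) by (simp only: cong_mult_lcancel)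
      with x show False by (simp add: cong_def)
    qed
    ultimately have "card {?x 0, ?x 1, ?x 2} = 3" using x by auto
    moreover have "{?x 0, ?x 1, ?x 2} \<subseteq> {?x i |i. True}" by blast
    moreover have "finite {?x i |i. True}"
      by (rule finite_subset[of _ "Zn n"]) (auto simp: n_pos)
    ultimately show "3 \<le> card {?x i |i. True}" using card_mono by metis
  qed (use n_pos in auto)
  then obtain N where N: "card (mult_invariant n a) \<le> 2 ^ N"
    "3 * N \<le> (n - 1) + 2 * card {x \<in> Zn n - {0}. a * x mod int n = x}" by auto
  have "3 * N \<le> (n - 1) + 2 * (n div p - 1)"
    using N(2) card_fixed_multiplier_le[OF n odd p_least _ a] p(2) by fastforce
  \<comment> \<open>With \<open>k = m div p\<close> the previous bound reads
    \<open>3 * N \<le> 2 * m + 4 * k - 3\<close>; the claim reduces to \<open>3 * k \<le> m\<close>,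
    which holds since \<open>p \<ge> 3\<close>.\<close>
  then have "9 * N + n \<le> 9 * M"
    using div_p_bounds m_ge_3 by (simp add: n_div_p M_def) (simp add: n)
  then have "N + n div 9 \<le> M" by simp
  have "card (mult_invariant n a) * 2 ^ (n div 9) \<le> 2 ^ N * 2 ^ (n div 9)"
    using N(1) by (rule mult_right_mono) simp
  also have "\<dots> = 2 ^ (N + n div 9)" by (simp only: power_add)
  also have "\<dots> \<le> 2 ^ M" using \<open>N + n div 9 \<le> M\<close> by (intro power_increasing) auto
  finally show ?thesis .
qed

section \<open>Reduction to involutions and multipliers of odd order\<close>

definition involutions :: "int set" where
  "involutions = {a. 1 < a \<and> a < int n \<and> [a ^ 2 = 1] (mod int n)}"

lemma mod_n_gt_1:
  assumes "\<not> [b = 1] (mod int n)" "coprime b (int n)"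
  shows "1 < b mod int n" "b mod int n < int n"
proof -
  have n1: "int n > 1" using n_pos by simp
  then show "b mod int n < int n" by simp
  have "b mod int n \<noteq> 1" using assms(1) n1 by (simp add: cong_def)
  moreover have "coprime (b mod int n) (int n)" using assms(2) n1 by simp
  then have "b mod int n \<noteq> 0" using n1 by auto
  moreover have "b mod int n \<ge> 0" using n1 by simp
  ultimately show "1 < b mod int n" by linarith
qed

text \<open>If \<open>a\<close> has exponent \<open>2\<^sup>s t\<close> with \<open>t\<close> odd, then either \<open>a\<^sup>t\<close> is trivial, or the last nontrivial
  term of the sequence \<open>a\<^sup>t, a\<^sup>2\<^sup>t, a\<^sup>4\<^sup>t, \<dots>\<close> is an involution.\<close>

lemma multiplier_cases:
  assumes a: "coprime a (int n)" "1 < a" "a < int n" and S: "S \<in> mult_invariant n a"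
  obtains b where "b \<in> involutions" "S \<in> mult_invariant n b"
  | b N where "coprime b (int n)" "1 < b" "b < int n" "[b ^ N = 1] (mod int n)" "odd N"
    "S \<in> mult_invariant n b"
proof -
  have n1: "n > 1" by (rule n_pos)
  obtain K where K: "K > 0" "[a ^ K = 1] (mod int n)" by (rule power_mod_one[OF a(1) n1])
  obtain s t where st: "K = 2 ^ s * t" "odd t"
    by (rule multiplicity_decompose'[of K 2]) (use K(1) in auto)
  show thesis
  proof (cases "[a ^ t = 1] (mod int n)")
    case True
    show thesis by (rule that(2)[OF a True st(2) S])
  next
    case False
    define Q where "Q = (\<lambda>j. [a ^ (2 ^ j * t) = 1] (mod int n))"
    define j where "j = (LEAST j. Q j)"
    have "Q s" using K(2) unfolding Q_def st(1) .
    then have "Q j" unfolding j_def by (rule LeastI)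
    then have j: "[a ^ (2 ^ j * t) = 1] (mod int n)" unfolding Q_def .
    \<comment> \<open>\<open>Q 0\<close> is the case excluded above, so the least index has a
      predecessor; there the power is nontrivial but its square is trivial.\<close>
    have "j \<noteq> 0" using False j by (cases j) auto
    then obtain i where i: "j = Suc i" by (cases j) auto
    define c where "c = a ^ (2 ^ i * t)"
    have "\<not> Q i" using not_less_Least[of i Q] i unfolding j_def[symmetric] by simp
    then have "\<not> [c = 1] (mod int n)" by (simp add: Q_def c_def)
    then have "1 < c mod int n" "c mod int n < int n"
      using mod_n_gt_1[of c] a(1) by (simp_all add: c_def)
    moreover have "c ^ 2 = a ^ (2 ^ j * t)"
      by (simp add: c_def i power_mult[symmetric] mult_ac)
    then have "[(c mod int n) ^ 2 = 1] (mod int n)" using j by (simp add: cong_def mod_simps)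
    ultimately have "c mod int n \<in> involutions" by (simp add: involutions_def)
    moreover have "S \<in> mult_invariant n (c mod int n)"
      unfolding c_def using mult_invariant_power[OF S] n1 by simp
    ultimately show thesis by (rule that(1))
  qed
qed

text \<open>Each involution contributes at most \<open>2 ^ M\<close> sets. There are at most
  \<open>n\<close> multipliers of odd order, each contributing at most \<open>2 ^ M\<close> divided
  by \<open>2 ^ (n div 9)\<close>; \<open>big\<close> absorbs the factor \<open>n\<close>, so
  together they cost one further \<open>2 ^ M\<close>.\<close>

lemma card_Nor_minus_DRR_le:
  assumes big: "n \<le> 2 ^ (n div 9)"
  shows "card (Nor n - DRR n) \<le> (card involutions + 1) * 2 ^ M"
proof -
  have n0: "n > 0" using n_pos by simp
  define V where "V = {b. coprime b (int n) \<and> 1 < b \<and> b < int n \<and> (\<exists>N. [b ^ N = 1] (mod int n) \<and> odd N)}"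
  have V: "finite V" "card V \<le> n"
  proof -
    have sub: "V \<subseteq> Zn n" by (auto simp: V_def Zn_def)
    then show "finite V" by (rule finite_subset) simp
    from card_mono[OF _ sub] show "card V \<le> n" by (simp add: Zn_def)
  qed
  have I: "finite involutions"
    by (rule finite_subset[of _ "Zn n"]) (auto simp: involutions_def Zn_def)
  let ?F = "mult_invariant n"
  have "Nor n - DRR n \<subseteq> circulant n ` ((\<Union>b\<in>involutions. ?F b) \<union> (\<Union>b\<in>V. ?F b))"
  proof
    fix \<Gamma> assume \<Gamma>: "\<Gamma> \<in> Nor n - DRR n"
    then obtain S where S: "\<Gamma> = circulant n S" "S \<subseteq> Zn n - {0}"
      by (auto simp: Nor_def Circulants_def)
    obtain a where a: "1 < a" "a < int n" "coprime a (int n)"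
      "\<forall>x \<in> Zn n. a * x mod int n \<in> S \<longleftrightarrow> x \<in> S"
      using normal_not_DRR_multiplier[OF n0 \<Gamma>[unfolded S]] .
    then have Sa: "S \<in> ?F a" using S by (simp add: mult_invariant_def)
    have "S \<in> (\<Union>b\<in>involutions. ?F b) \<union> (\<Union>b\<in>V. ?F b)"
    proof (rule multiplier_cases[OF a(3) a(1,2) Sa])
      fix b N assume "coprime b (int n)" "1 < b" "b < int n" "[b ^ N = 1] (mod int n)" "odd N"
        and "S \<in> ?F b"
      moreover from this have "b \<in> V" unfolding V_def by blast
      ultimately show ?thesis by blast
    qed blast
    then show "\<Gamma> \<in> circulant n ` ((\<Union>b\<in>involutions. ?F b) \<union> (\<Union>b\<in>V. ?F b))"
      using S(1) by blast
  qed
  then have "card (Nor n - DRR n) \<le> card ((\<Union>b\<in>involutions. ?F b) \<union> (\<Union>b\<in>V. ?F b))"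
    by (rule surj_card_le[rotated]) (simp add: I V finite_mult_invariant)
  also have "\<dots> \<le> card (\<Union>b\<in>involutions. ?F b) + card (\<Union>b\<in>V. ?F b)" by (rule card_Un_le)
  also have "card (\<Union>b\<in>involutions. ?F b) \<le> (\<Sum>b\<in>involutions. card (?F b))"
    by (rule card_UN_le[OF I])
  also have "\<dots> \<le> card involutions * 2 ^ M"
  proof -
    have "coprime b (int n)" if "b \<in> involutions" for b
    proof -
      have "[b * b = 1] (mod int n)" using that by (simp add: involutions_def power2_eq_square)
      then show ?thesis using coprime_iff_invertible_int by blast
    qed
    then have "card (?F b) \<le> 2 ^ M" if "b \<in> involutions" for b
      using that by (intro card_mult_invariant_involution_le) (auto simp: involutions_def)
    then show ?thesis using sum_bounded_above[of involutions "\<lambda>b. card (?F b)" "2 ^ M"] by simp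
  qed
  also have "card (\<Union>b\<in>V. ?F b) \<le> 2 ^ M"
  proof -
    have "card (\<Union>b\<in>V. ?F b) \<le> (\<Sum>b\<in>V. card (?F b))" by (rule card_UN_le[OF V(1)])
    then have "card (\<Union>b\<in>V. ?F b) * 2 ^ (n div 9) \<le> (\<Sum>b\<in>V. card (?F b)) * 2 ^ (n div 9)" by simp
    also have "\<dots> = (\<Sum>b\<in>V. card (?F b) * 2 ^ (n div 9))" by (rule sum_distrib_right)
    also have "\<dots> \<le> card V * 2 ^ M"
    proof -
      have "card (?F b) * 2 ^ (n div 9) \<le> 2 ^ M" if "b \<in> V" for b
        using that card_mult_invariant_odd_order_le by (auto simp: V_def)
      then show ?thesis using sum_bounded_above[of V "\<lambda>b. card (?F b) * 2 ^ (n div 9)" "2 ^ M"] by simp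
    qed
    also have "\<dots> \<le> 2 ^ (n div 9) * 2 ^ M" using V(2) big by (intro mult_right_mono) auto
    finally show ?thesis by (simp add: mult.commute)
  qed
  finally show ?thesis by (simp add: algebra_simps)
qed

end

section \<open>Square roots of 1 modulo n\<close>

text \<open>An odd prime dividing both \<open>a - 1\<close> and \<open>a + 1\<close> would divide 2,
  so the whole power falls on one factor.\<close>

lemma odd_prime_power_dvd_square_minus_1:
  fixes q a :: int
  assumes "prime q" "odd q" "q ^ e dvd a ^ 2 - 1"
  shows "q ^ e dvd a - 1 \<or> q ^ e dvd a + 1"
proof -
  have dvd: "q ^ e dvd (a - 1) * (a + 1)"
    using assms(3) by (simp add: power2_eq_square algebra_simps)
  have "\<not> (q dvd a - 1 \<and> q dvd a + 1)"
  proof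
    assume "q dvd a - 1 \<and> q dvd a + 1"
    then have "q dvd (a + 1) - (a - 1)" by (metis dvd_diff)
    then have "q dvd 2" by simp
    then have "q \<le> 2" by (rule zdvd_imp_le) simp
    moreover have "q \<ge> 2" using assms(1) by (rule prime_ge_2_int)
    ultimately show False using assms(2) by simp
  qed
  then consider "coprime (q ^ e) (a - 1)" | "coprime (q ^ e) (a + 1)"
    using assms(1) prime_imp_coprime[of q] by (auto intro: coprime_power_left_iff[THEN iffD2])
  then show ?thesis
    using dvd by cases (simp_all add: coprime_dvd_mult_right_iff coprime_dvd_mult_left_iff)
qed

text \<open>By the Chinese remainder theorem a square root of 1 is determined by the indices at
  which it is -1; oddness settles the factor 2. Including the trivial root 1 in the domain of the
  injection accounts for the \<open>+ 1\<close>.\<close>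

lemma card_involutions_le:
  fixes q e :: "nat \<Rightarrow> nat"
  assumes inj: "inj_on q {1..r}" and q: "\<And>i. i \<in> {1..r} \<Longrightarrow> prime (q i) \<and> odd (q i)"
    and n: "n = 2 * (\<Prod>i = 1..r. q i ^ e i)" "n > 1"
  shows "card {a. 1 < a \<and> a < int n \<and> [a ^ 2 = 1] (mod int n)} + 1 \<le> 2 ^ r"
proof -
  let ?I = "{a. 1 < a \<and> a < int n \<and> [a ^ 2 = 1] (mod int n)}"
  let ?q = "\<lambda>i. int (q i ^ e i)"
  let ?\<phi> = "\<lambda>a. {i \<in> {1..r}. ?q i dvd a + 1}"
  have nq: "int n = 2 * (\<Prod>i \<in> {1..r}. ?q i)" by (simp add: n(1))
  have dvd: "2 dvd int n" "\<And>i. i \<in> {1..r} \<Longrightarrow> ?q i dvd int n"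
    unfolding nq by (auto intro!: dvd_mult dvd_prodI)
  have I: "odd a" "\<And>i. i \<in> {1..r} \<Longrightarrow> ?q i dvd a - 1 \<or> ?q i dvd a + 1"
    if "a \<in> insert 1 ?I" for a
  proof -
    from that have "[a ^ 2 = 1] (mod int n)" by auto
    then have *: "int n dvd a ^ 2 - 1" by (simp add: cong_iff_dvd_diff)
    then have "2 dvd a ^ 2 - 1" using dvd(1) by (rule dvd_trans[rotated])
    then show "odd a" by auto
    show "?q i dvd a - 1 \<or> ?q i dvd a + 1" if "i \<in> {1..r}" for i
      using odd_prime_power_dvd_square_minus_1[of "int (q i)" "e i" a]
        q[OF that] dvd_trans[OF dvd(2)[OF that] *] by simp
  qed
  have "inj_on ?\<phi> (insert 1 ?I)"
  proof (rule inj_onI)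
    fix a b assume a: "a \<in> insert 1 ?I" and b: "b \<in> insert 1 ?I" and eq: "?\<phi> a = ?\<phi> b"
    have "[a = b] (mod ?q i)" if i: "i \<in> {1..r}" for i
    proof (cases "i \<in> ?\<phi> a")
      case True
      then have "?q i dvd a + 1" "?q i dvd b + 1" using eq by auto
      then have "?q i dvd (a + 1) - (b + 1)" by (rule dvd_diff)
      then show ?thesis by (simp add: cong_iff_dvd_diff)
    next
      case False
      then have "?q i dvd a - 1" "?q i dvd b - 1" using I(2)[OF a i] I(2)[OF b i] eq i by auto
      then have "?q i dvd (a - 1) - (b - 1)" by (rule dvd_diff)
      then show ?thesis by (simp add: cong_iff_dvd_diff)
    qed
    moreover have "coprime (?q i) (?q j)" if "i \<in> {1..r}" "j \<in> {1..r}" "i \<noteq> j" for i j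
    proof -
      have "q i \<noteq> q j" using inj that by (auto dest: inj_onD)
      then have "coprime (q i) (q j)" using q that by (intro primes_coprime) auto
      then show ?thesis unfolding coprime_int_iff by (metis coprime_power_left_iff coprime_power_right_iff)
    qed
    ultimately have "[a = b] (mod (\<Prod>i\<in>{1..r}. ?q i))"
      by (intro cong_cong_prod_coprime) auto
    moreover have "[a = b] (mod 2)"
      using I(1)[OF a] I(1)[OF b] by (simp add: cong_iff_dvd_diff)
    moreover have "coprime 2 (\<Prod>i\<in>{1..r}. ?q i)"
      using q by (intro prod_coprime_right) auto
    ultimately have "[a = b] (mod int n)"
      unfolding nq by (intro coprime_cong_mult)
    moreover have "0 \<le> a" "a < int n" "0 \<le> b" "b < int n" using a b n(2) by auto
    ultimately show "a = b" by (simp add: cong_def)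
  qed
  then have "card (insert 1 ?I) \<le> card (Pow {1..r})"
    by (rule card_inj_on_le) auto
  moreover have "finite ?I" by (rule finite_subset[of _ "{0..int n}"]) auto
  ultimately show ?thesis by (simp add: card_Pow)
qed

section \<open>Finiteness and nonemptiness of the denominator\<close>

lemma finite_Circulants: "finite (Circulants n)"
  by (simp add: Circulants_def)

text \<open>A nonempty denominator is needed because division by zero yields zero in HOL.\<close>

lemma cycle_in_Nor_minus_DRR:
  assumes n: "n \<ge> 3"
  shows "circulant n {1, int n - 1} \<in> Nor n - DRR n"
proof -
  let ?S = "{1, int n - 1}"
  have n0: "n > 0" using n by simp
  have Z: "0 \<in> Zn n" "1 \<in> Zn n" using n by (auto simp: Zn_def)
  have "\<exists>k. \<forall>x \<in> Zn n. f ((x + 1) mod int n) = (f x + k) mod int n"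
    if f: "f \<in> Aut (circulant n ?S)" for f
  proof -
    \<comment> \<open>\<open>d x\<close> is the direction, 1 or -1 modulo \<open>n\<close>, of the
      step of \<open>f\<close> from \<open>x\<close> to \<open>x + 1\<close>; the aim is to show it
      constant.\<close>
    define d where "d = (\<lambda>x. (f ((x + 1) mod int n) - f x) mod int n)"
    have fB: "f \<in> Bij (Zn n)" using f by (simp add: Aut_circulant_iff n0)
    then have fZ: "f x \<in> Zn n" if "x \<in> Zn n" for x using that by (auto dest: Bij_imp_funcset)
    have f_inj: "inj_on f (Zn n)" using fB by (simp add: Bij_def bij_betw_def)
    have step: "f ((x + 1) mod int n) = (f x + d x) mod int n" if "x \<in> Zn n" for x
      using fZ[of "(x + 1) mod int n"] n0 by (simp add: d_def mod_simps)
    have dS: "d x \<in> ?S" if "x \<in> Zn n" for x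
    proof -
      have "((x + 1) mod int n - x) mod int n = 1" using n by (simp add: mod_simps)
      then have "((x + 1) mod int n - x) mod int n \<in> ?S" by simp
      then show ?thesis
        using f that n0 unfolding Aut_circulant_iff[OF n0] d_def by (meson mod_in_Zn)
    qed
    have d_Suc: "d ((x + 1) mod int n) = d x" if x: "x \<in> Zn n" for x
    proof (rule ccontr)
      let ?y = "(x + 1) mod int n"
      assume ne: "d ?y \<noteq> d x"
      have y: "?y \<in> Zn n" using n0 by simp
      \<comment> \<open>Opposite directions cancel, so \<open>f\<close> would repeat a value after
        two steps, and injectivity would make \<open>n\<close> divide 2.\<close>
      have "d ?y + d x = int n" using dS[OF x] dS[OF y] ne by auto
      moreover have "f ((?y + 1) mod int n) = (f x + (d ?y + d x)) mod int n"
        unfolding step[OF y] step[OF x] by (simp add: mod_simps algebra_simps)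
      ultimately have "f ((?y + 1) mod int n) = f x" using fZ[OF x] by simp
      then have "(?y + 1) mod int n = x" using f_inj x n0 by (auto dest: inj_onD)
      then have "(x + 2) mod int n = x mod int n" using x by (simp add: mod_simps add.commute)
      then have "int n dvd 2" by (simp add: mod_eq_dvd_iff)
      then show False using n by (auto dest: zdvd_imp_le)
    qed
    have "d (int j) = d 0" if "j < n" for j
      using that
    proof (induction j)
      case (Suc j)
      then have "int j \<in> Zn n" "(int j + 1) mod int n = int (Suc j)" by (auto simp: Zn_def)
      with d_Suc[of "int j"] Suc show ?case by simp
    qed simp
    then have "d x = d 0" if "x \<in> Zn n" for x
      using that by (metis Zn_def atLeastLessThan_iff nat_0_le nat_less_iff)
    with step show ?thesis by metis
  qed
  then have "rho_group n \<lhd> AutGroup (circulant n ?S)" by (simp add: normal_circulant_iff n0)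
  moreover have "circulant n ?S \<in> Circulants n" using n by (auto simp: Circulants_def Zn_def)
  moreover have "Aut (circulant n ?S) \<noteq> rho_group n"
  proof -
    \<comment> \<open>Reflection preserves the symmetric connection set; it fixes 0 but moves 1, so
      it is no translation.\<close>
    let ?neg = "\<lambda>x \<in> Zn n. (- x) mod int n"
    have neg_S: "(- x) mod int n \<in> ?S \<longleftrightarrow> x mod int n \<in> ?S" for x
    proof -
      have "(- x) mod int n = (if x mod int n = 0 then 0 else int n - x mod int n)"
        by (rule zmod_zminus1_eq_if)
      moreover have "x mod int n \<ge> 0" "x mod int n < int n" using n0 by simp_all
      ultimately show ?thesis using n by auto
    qed
    have "?neg \<in> Bij (Zn n)"
    proof (rule Bij_ZnI)
      show "inj_on ?neg (Zn n)"
      proof (rule inj_onI)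
        fix x y assume xy: "x \<in> Zn n" "y \<in> Zn n" "?neg x = ?neg y"
        then have "[- x = - y] (mod int n)" by (simp add: cong_def)
        then have "[x = y] (mod int n)" using cong_minus_minus_iff by blast
        with xy show "x = y" by (simp add: cong_def)
      qed
    qed (use n0 in auto)
    moreover have "(?neg u - ?neg v) mod int n \<in> ?S \<longleftrightarrow> (u - v) mod int n \<in> ?S"
      if "u \<in> Zn n" "v \<in> Zn n" for u v
    proof -
      have "(?neg u - ?neg v) mod int n = (- (u - v)) mod int n"
        using that by (simp add: mod_simps)
      then show ?thesis by (simp only: neg_S)
    qed
    ultimately have "?neg \<in> Aut (circulant n ?S)" by (simp add: Aut_circulant_iff n0)
    moreover have "?neg \<noteq> transl n k" for k
    proof
      assume eq: "?neg = transl n k"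
      have "k mod int n = 0" using fun_cong[OF eq, of 0] Z by (simp add: transl_def)
      then have "transl n k 1 = 1" using Z n by (simp add: transl_def mod_add_eq[symmetric])
      moreover have "?neg 1 = int n - 1" using Z n by (simp add: zmod_minus1)
      ultimately show False using n unfolding eq by simp
    qed
    ultimately show ?thesis by (auto simp: rho_group_eq n0)
  qed
  ultimately show ?thesis by (simp add: Nor_def DRR_def)
qed

subsection \<open>Non-normal circulants\<close>

context twice_odd
begin

definition w :: nat where "w = n div p"

lemma w_props: "n = p * w" "even w" "w > 0" "int w dvd int n"
proof -
  have "p * w = 2 * (p * (m div p))" by (simp add: w_def n_div_p)
  then show "n = p * w" using p(1) by (simp add: n)
  then show "int w dvd int n" by (metis dvd_triv_right of_nat_dvd_iff)
  show "even w" by (simp add: w_def n_div_p)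
  show "w > 0" using div_p_bounds by (simp add: w_def n_div_p)
qed

lemma even_mod_n: "even (x mod int n) \<longleftrightarrow> even x"
  by (rule dvd_mod_iff) (simp add: n)

text \<open>Membership of odd residues becomes invariant under translation by \<open>w\<close>,
  while even ones stay free; as \<open>w\<close> is even, classes modulo \<open>w\<close> respect
  parity. \<open>U\<close> encodes the choices at representatives.\<close>

definition half_wreath :: "int set \<Rightarrow> int set" where
  "half_wreath U = {x \<in> Zn n. x \<noteq> 0 \<and> (if even x then x \<in> U else x mod int w \<in> U)}"

text \<open>The free coordinates of the construction: \<open>m - 1\<close> even and
  \<open>m div p\<close> odd ones, in total again \<open>M\<close>.\<close>

definition wreath_reps :: "int set" where
  "wreath_reps = {x \<in> Zn n. x \<noteq> 0 \<and> even x} \<union> {x \<in> Zn n. odd x \<and> x < int w}"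

lemma card_wreath_reps: "card wreath_reps = M"
proof -
  have "{x \<in> Zn n. x \<noteq> 0 \<and> even x} = (\<lambda>j. 2 * int j) ` {1..<m}" (is "?A = _")
  proof
    show "?A \<subseteq> (\<lambda>j. 2 * int j) ` {1..<m}"
    proof
      fix x assume "x \<in> ?A"
      then have "x = 2 * int (nat (x div 2))" "nat (x div 2) \<in> {1..<m}" by (auto simp: Zn_def n)
      then show "x \<in> (\<lambda>j. 2 * int j) ` {1..<m}" by (rule image_eqI)
    qed
  qed (auto simp: Zn_def n)
  then have A: "card ?A = m - 1" by (simp add: card_image inj_on_def)
  have "w \<le> n" using zdvd_imp_le[OF w_props(4)] n_pos by simp
  have wk: "w = 2 * (m div p)" by (simp add: w_def n_div_p)
  have "{x \<in> Zn n. odd x \<and> x < int w} = (\<lambda>j. 2 * int j + 1) ` {..<m div p}" (is "?B = _")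
  proof
    show "?B \<subseteq> (\<lambda>j. 2 * int j + 1) ` {..<m div p}"
    proof
      fix x assume "x \<in> ?B"
      then have "0 \<le> x" "odd x" "x < 2 * int (m div p)" by (auto simp: Zn_def wk)
      then have "x = 2 * int (nat (x div 2)) + 1" "nat (x div 2) \<in> {..<m div p}"
        by (auto simp del: of_nat_div simp: nat_less_iff elim!: oddE)
      then show "x \<in> (\<lambda>j. 2 * int j + 1) ` {..<m div p}" by (rule image_eqI)
    qed
    show "(\<lambda>j. 2 * int j + 1) ` {..<m div p} \<subseteq> ?B"
      using \<open>w \<le> n\<close> by (auto simp: Zn_def wk)
  qed
  then have B: "card ?B = m div p" by (simp add: card_image inj_on_def)
  have "card wreath_reps = card ?A + card ?B"
    unfolding wreath_reps_def by (rule card_Un_disjoint) auto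
  then show ?thesis using A B m_ge_3 by (simp add: M_def)
qed

lemma half_wreath_inj: "inj_on half_wreath (Pow wreath_reps)"
proof (rule inj_onI)
  fix U U' assume U: "U \<in> Pow wreath_reps" "U' \<in> Pow wreath_reps" "half_wreath U = half_wreath U'"
  have "V = half_wreath V \<inter> wreath_reps" if "V \<in> Pow wreath_reps" for V
  proof -
    have "x mod int w = x" if "x \<in> Zn n" "x < int w" for x using that by (simp add: Zn_def)
    with that show ?thesis by (auto simp: half_wreath_def wreath_reps_def)
  qed
  with U show "U = U'" by metis
qed

lemma odd_mem_half_wreath:
  assumes "odd z"
  shows "z mod int n \<in> half_wreath U \<longleftrightarrow> z mod int w \<in> U"
proof -
  have "odd (z mod int n)" using assms by (simp add: even_mod_n)
  moreover from this have "z mod int n \<noteq> 0" by auto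
  ultimately show ?thesis
    using n_pos w_props(4) by (simp add: half_wreath_def mod_mod_cancel)
qed

text \<open>The permutation translating the even residues by \<open>n / p\<close> and fixing the odd ones is an
  automorphism that does not normalise the translations.\<close>

lemma half_wreath_NonNor: "circulant n (half_wreath U) \<in> NonNor n"
proof -
  let ?S = "half_wreath U"
  let ?\<tau> = "\<lambda>x \<in> Zn n. if even x then (x + int w) mod int n else x"
  have "?\<tau> \<in> Bij (Zn n)"
  proof (rule Bij_ZnI)
    show "inj_on ?\<tau> (Zn n)"
    proof (rule inj_onI)
      fix x y assume xy: "x \<in> Zn n" "y \<in> Zn n" "?\<tau> x = ?\<tau> y"
      have ev: "even (?\<tau> z) \<longleftrightarrow> even z" if "z \<in> Zn n" for z
        using that w_props(2) by (simp add: even_mod_n)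
      have par: "even x \<longleftrightarrow> even y"
        using ev[OF xy(1)] ev[OF xy(2)] unfolding xy(3) by blast
      show "x = y"
      proof (cases "even x")
        case True
        then have "[x + int w = y + int w] (mod int n)" using xy par by (simp add: cong_def)
        then have "[x = y] (mod int n)" by (simp only: cong_add_rcancel)
        with xy show ?thesis by (simp add: cong_def)
      qed (use xy par in simp)
    qed
  qed (auto simp: n_pos)
  \<comment> \<open>For equal parities the difference is unchanged. For opposite parities it is odd
    and moves by \<open>w\<close> up or down, which membership of odd residues does not see.\<close>
  moreover have "(?\<tau> u - ?\<tau> v) mod int n \<in> ?S \<longleftrightarrow> (u - v) mod int n \<in> ?S"
    if uv: "u \<in> Zn n" "v \<in> Zn n" for u v
  proof (cases "even u"; cases "even v")
    assume "even u" "even v"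
    then have "(?\<tau> u - ?\<tau> v) mod int n = (u - v) mod int n" using uv by (simp add: mod_simps)
    then show ?thesis by simp
  next
    assume par: "even u" "odd v"
    then have "(?\<tau> u - ?\<tau> v) mod int n = (u - v + int w) mod int n"
      using uv by (simp add: mod_simps algebra_simps)
    moreover have "(u - v + int w) mod int w = (u - v) mod int w" by simp
    ultimately show ?thesis using par w_props(2) by (simp only:) (simp add: odd_mem_half_wreath)
  next
    assume par: "odd u" "even v"
    then have "(?\<tau> u - ?\<tau> v) mod int n = (u - v - int w) mod int n"
      using uv by (simp add: mod_simps algebra_simps)
    moreover have "(u - v - int w) mod int w = (u - v) mod int w" by simp
    ultimately show ?thesis using par w_props(2) by (simp only:) (simp add: odd_mem_half_wreath)
  qed (use uv in simp)
  ultimately have \<tau>: "?\<tau> \<in> Aut (circulant n ?S)" by (simp add: Aut_circulant_iff n_pos)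
  have "\<not> rho_group n \<lhd> AutGroup (circulant n ?S)"
  proof
    assume "rho_group n \<lhd> AutGroup (circulant n ?S)"
    with \<tau> obtain k where k: "\<And>x. x \<in> Zn n \<Longrightarrow> ?\<tau> ((x + 1) mod int n) = (?\<tau> x + k) mod int n"
      unfolding normal_circulant_iff[OF n_pos(1)] by blast
    have small: "0 \<in> Zn n" "1 \<in> Zn n" "2 \<in> Zn n" using m_ge_3 by (auto simp: Zn_def n)
    then have m12: "1 mod int n = 1" "2 mod int n = 2" by simp_all
    \<comment> \<open>The steps from 0 to 1 and from 1 to 2 give \<open>k = 1 - w\<close> and
      \<open>k = 1 + w\<close> modulo \<open>n\<close>, so \<open>n = p * w\<close> would divide
      \<open>2 * w\<close>, against \<open>p \<ge> 3\<close>.\<close>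
    have "[1 = int w + k] (mod int n)" using k[of 0] small m12 by (simp add: cong_def mod_simps)
    moreover have "[2 + int w = 1 + k] (mod int n)"
      using k[of 1] small m12 by (simp add: cong_def mod_simps)
    ultimately have "[(2 + int w) - 1 = (1 + k) - (int w + k)] (mod int n)"
      by (intro cong_diff)
    then have "int n dvd 2 * int w" by (simp add: cong_iff_dvd_diff)
    then have "n \<le> 2 * w" using w_props(3) by (auto dest: zdvd_imp_le)
    moreover have "3 * w \<le> p * w" using p_ge_3 by (rule mult_right_mono) simp
    ultimately show False using w_props(1,3) by linarith
  qed
  moreover have "half_wreath U \<subseteq> Zn n - {0}" by (auto simp: half_wreath_def)
  ultimately show ?thesis by (auto simp: NonNor_def Circulants_def)
qed

lemma card_NonNor_ge: "2 ^ M \<le> card (NonNor n)"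
proof -
  have fin: "finite wreath_reps"
    by (rule finite_subset[of _ "Zn n"]) (auto simp: wreath_reps_def)
  have "half_wreath ` Pow wreath_reps \<subseteq> Pow (Zn n - {0})" by (auto simp: half_wreath_def)
  then have "inj_on (circulant n \<circ> half_wreath) (Pow wreath_reps)"
    by (intro comp_inj_on half_wreath_inj inj_on_subset[OF inj_on_circulant[OF n_pos(1)]])
  then have "card (Pow wreath_reps) \<le> card (NonNor n)"
  proof (rule card_inj_on_le)
    show "(circulant n \<circ> half_wreath) ` Pow wreath_reps \<subseteq> NonNor n"
      using half_wreath_NonNor by auto
    show "finite (NonNor n)"
      by (rule finite_subset[OF _ finite_Circulants[of n]]) (auto simp: NonNor_def)
  qed
  then show ?thesis by (simp add: card_Pow fin card_wreath_reps)
qed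

end

subsection \<open>The ratio\<close>

text \<open>The threshold is \<open>9 * 7\<close>: the induction starts at \<open>k = 7\<close>,
  where 71 is below 128, and the summand 8 covers the remainder modulo 9.\<close>

lemma le_two_power_div_9:
  assumes "n \<ge> 63"
  shows "n \<le> 2 ^ (n div 9)"
proof -
  have "9 * k + 8 \<le> 2 ^ k" if "k \<ge> 7" for k :: nat
    using that by (induction k rule: dec_induct) simp_all
  then have "9 * (n div 9) + 8 \<le> 2 ^ (n div 9)" using assms by simp
  moreover have "n \<le> 9 * (n div 9) + 8" by presburger
  ultimately show ?thesis by linarith
qed

lemma admissible_ratio_ge:
  assumes "r \<ge> 1" "n \<in> admissible_orders r" "n \<ge> 63"
  shows "1 / (4 * (2 ^ r - 1)) \<le> real (card (NonNor n)) / real (card (Nor n - DRR n))"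
proof -
  from assms(2) obtain q e where q: "inj_on q {1..r}"
    "\<And>i. i \<in> {1..r} \<Longrightarrow> prime (q i) \<and> odd (q i) \<and> e i \<ge> 1"
    and n_prod: "n = 2 * (\<Prod>i = 1..r. q i ^ e i)"
    unfolding admissible_orders_def by blast
  define m where "m = (\<Prod>i = 1..r. q i ^ e i)"
  have "odd m"
    unfolding m_def using q(2) by (subst even_prod_iff) auto
  have "m > 1" using assms(3) n_prod by (simp add: m_def)
  define p where "p = (LEAST q. q dvd m \<and> q > 1)"
  have p: "p dvd m \<and> p > 1" unfolding p_def by (rule LeastI[of _ m]) (use \<open>m > 1\<close> in simp)
  have p_least: "p \<le> q" if "q dvd m" "q > 1" for q
    unfolding p_def by (rule Least_le) (use that in simp)
  interpret twice_odd n m p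
    by unfold_locales (use n_prod \<open>odd m\<close> p p_least in \<open>simp_all add: m_def\<close>)
  have "card involutions + 1 \<le> 2 ^ r"
    unfolding involutions_def by (rule card_involutions_le[OF q(1) _ n_prod]) (use q(2) n_pos in auto)
  have fin: "finite (Nor n - DRR n)"
    by (rule finite_subset[OF _ finite_Circulants[of n]]) (auto simp: Nor_def)
  have "card (Nor n - DRR n) \<le> (card involutions + 1) * 2 ^ M"
    by (rule card_Nor_minus_DRR_le[OF le_two_power_div_9[OF assms(3)]])
  also have "\<dots> \<le> 2 ^ r * 2 ^ M"
    using \<open>card involutions + 1 \<le> 2 ^ r\<close> by (rule mult_right_mono) simp
  finally have "real (card (Nor n - DRR n)) \<le> real (2 ^ r * 2 ^ M)"
    by (simp only: of_nat_le_iff)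
  then have upper: "real (card (Nor n - DRR n)) \<le> 2 ^ r * 2 ^ M" by simp
  have pos: "card (Nor n - DRR n) > 0"
    using cycle_in_Nor_minus_DRR[of n] assms(3) fin by (auto simp: card_gt_0_iff)
  have "real (2 ^ M) \<le> real (card (NonNor n))"
    using card_NonNor_ge by (simp only: of_nat_le_iff)
  then have lower: "2 ^ M \<le> real (card (NonNor n))" by simp
  \<comment> \<open>From \<open>2 ^ r \<ge> 2\<close> follows
    \<open>4 * (2 ^ r - 1) \<ge> 2 ^ r > 0\<close>, so the claimed constant is at most
    \<open>1 / 2 ^ r\<close>.\<close>
  have "(2 :: real) ^ 1 \<le> 2 ^ r" using assms(1) by (rule power_increasing) simp
  then have "1 / (4 * (2 ^ r - 1)) \<le> 1 / (2 ^ r :: real)"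
    by (intro divide_left_mono mult_pos_pos) auto
  also have "\<dots> = 2 ^ M / (2 ^ r * 2 ^ M)" by simp
  also have "\<dots> \<le> real (card (NonNor n)) / real (card (Nor n - DRR n))"
    using lower upper pos by (intro frac_le) auto
  finally show ?thesis .
qed

text \<open>The filter lets \<open>n\<close> tend to infinity within the orders having exactly
  \<open>r\<close> distinct odd prime factors. Bounding the lower limit gives the inequality for the
  limit whenever that exists.\<close>

theorem theorem3p4:
  fixes r :: nat
  assumes "r \<ge> 1"
  shows "Liminf (inf sequentially (principal (admissible_orders r)))
           (\<lambda>n. ereal (real (card (NonNor n)) / real (card (Nor n - DRR n))))
         \<ge> ereal (1 / (4 * (2 ^ r - 1)))"
proof (rule Liminf_bounded)
  show "eventually (\<lambda>n. ereal (1 / (4 * (2 ^ r - 1)))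
      \<le> ereal (real (card (NonNor n)) / real (card (Nor n - DRR n))))
    (inf sequentially (principal (admissible_orders r)))"
    unfolding eventually_inf_principal
    using eventually_ge_at_top[of 63]
    by eventually_elim (use admissible_ratio_ge[OF assms] in simp)
qed

end
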